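(* Every graph with fractional chromatic number $k$ and average degree $d$ has a bipartite induced subgraph of average degree at least $d/k$.
   Context: All graphs are finite and simple with at least one vertex. The fractional chromatic number of a graph $G$ is the smallest $k$ such that there is a probability distribution over the stable (independent) sets of $G$ for which a random stable set $\mathbf S$ drawn from it satisfies $\Pr(v\in\mathbf S)\ge 1/k$ for every vertex $v$. *)

theory Defs
  imports "Graph_Theory.Graph_Theory" "HOL-Probability.Probability"
begin

text \<open>
  A finite simple graph is represented by the locale \<^locale>\<open>graph\<close>: a finite, loop-free
  digraph without parallel arcs whose adjacency relation is symmetric. Each undirected edge
  corresponds to a pair of opposite arcs.
\<close>

definition stable_set :: "('a, 'b) pre_digraph \<Rightarrow> 'a set \<Rightarrow> bool" where
  "stable_set G S \<longleftrightarrow> S \<subseteq> verts G \<and> (\<forall>u\<in>S. \<forall>v\<in>S. \<not> u \<rightarrow>\<^bsub>G\<^esub> v)"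

definition bipartite :: "('a, 'b) pre_digraph \<Rightarrow> bool" where
  "bipartite G \<longleftrightarrow>
     (\<exists>A B. A \<union> B = verts G \<and> A \<inter> B = {} \<and> stable_set G A \<and> stable_set G B)"

text \<open>
  In a \<^locale>\<open>graph\<close>, the out-degree of a vertex is its number of neighbours.
\<close>

definition average_degree :: "('a, 'b) pre_digraph \<Rightarrow> real" where
  "average_degree G = (\<Sum>v\<in>verts G. real (out_degree G v)) / real (card (verts G))"

text \<open>
  The condition \<open>0 < k\<close> is needed because \<open>1 / k \<le> 0\<close> in HOL for all \<open>k \<le> 0\<close>.
\<close>

definition fractionally_colourable :: "('a, 'b) pre_digraph \<Rightarrow> real \<Rightarrow> bool" where
  "fractionally_colourable G k \<longleftrightarrow>
     0 < k \<and>
     (\<exists>p :: 'a set pmf. (\<forall>S\<in>set_pmf p. stable_set G S) \<and>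
        (\<forall>v\<in>verts G. measure_pmf.prob p {S. v \<in> S} \<ge> 1 / k))"

definition fractional_chromatic_number :: "('a, 'b) pre_digraph \<Rightarrow> real" where
  "fractional_chromatic_number G = (LEAST k. fractionally_colourable G k)"

text \<open>The minimum is attained, so the use of \<^const>\<open>Least\<close> is justified.\<close>

lemma convergent_subseq_on_finite:
  fixes f :: "nat \<Rightarrow> 'c \<Rightarrow> real"
  assumes "finite A" and bnd: "\<And>n x. f n x \<in> {0..1}"
  shows "\<exists>r. strict_mono r \<and> (\<forall>x\<in>A. convergent (\<lambda>n. f (r n) x))"
  using assms(1)
proof (induction A rule: finite_induct)
  case empty
  show ?case by (rule exI[of _ id]) (auto simp: strict_mono_def)
next
  case (insert a A)
  then obtain r where r: "strict_mono r" "\<forall>x\<in>A. convergent (\<lambda>n. f (r n) x)" by blast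
  have "seq_compact {0..1::real}"
    by (simp add: compact_imp_seq_compact)
  then obtain l s where s: "strict_mono s" "((\<lambda>n. f (r n) a) \<circ> s) \<longlonglongrightarrow> l"
    using bnd by (meson seq_compactE)
  have 1: "convergent (\<lambda>n. f ((r \<circ> s) n) x)" if "x \<in> A" for x
    using r(2) that s(1) convergent_subseq_convergent[of "\<lambda>n. f (r n) x" s]
    by (auto simp: o_def)
  have 2: "convergent (\<lambda>n. f ((r \<circ> s) n) a)"
    using s(2) by (auto simp: convergent_def o_def)
  show ?case
    using 1 2 strict_mono_o[OF r(1) s(1)] by blast
qed

lemma prob_finite_support:
  fixes p :: "'c pmf"
  assumes "finite A" "set_pmf p \<subseteq> A"
  shows "measure_pmf.prob p B = (\<Sum>x\<in>A \<inter> B. pmf p x)"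
proof -
  have "measure_pmf.prob p B = measure_pmf.prob p (A \<inter> B)"
    using assms(2) by (intro measure_prob_cong_0) (auto simp: set_pmf_iff)
  also have "\<dots> = (\<Sum>x\<in>A \<inter> B. pmf p x)"
    using assms(1) by (intro measure_measure_pmf_finite) auto
  finally show ?thesis .
qed

lemma fractionally_colourable_ge_1:
  assumes "verts G \<noteq> {}" "fractionally_colourable G k"
  shows "1 \<le> k"
proof -
  obtain v where "v \<in> verts G" using assms(1) by blast
  then obtain p :: "'a set pmf" where k: "0 < k" "1 / k \<le> measure_pmf.prob p {S. v \<in> S}"
    using assms(2) unfolding fractionally_colourable_def by blast
  have "1 / k \<le> 1"
    using k(2) measure_pmf.prob_le_1 order_trans by blast
  then show ?thesis using k(1) by simp
qed

lemma fractionally_colourable_card: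
  assumes "graph G" "verts G \<noteq> {}"
  shows "fractionally_colourable G (real (card (verts G)))"
proof -
  interpret graph G by fact
  let ?A = "(\<lambda>v. {v}) ` verts G"
  have A: "finite ?A" "?A \<noteq> {}" using assms(2) by auto
  have c: "card ?A = card (verts G)" by (rule card_image) auto
  have st: "stable_set G {v}" if "v \<in> verts G" for v
    using that no_loops by (auto simp: stable_set_def arcs_ends_conv)
  have "1 / real (card (verts G)) \<le> measure_pmf.prob (pmf_of_set ?A) {S. v \<in> S}"
    if "v \<in> verts G" for v
  proof -
    have "1 / real (card (verts G)) = pmf (pmf_of_set ?A) {v}"
      using that A c by (simp add: pmf_of_set)
    also have "\<dots> = measure_pmf.prob (pmf_of_set ?A) {{v}}"
      by (simp add: measure_pmf_single)
    also have "\<dots> \<le> measure_pmf.prob (pmf_of_set ?A) {S. v \<in> S}"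
      by (intro measure_pmf.finite_measure_mono) auto
    finally show ?thesis .
  qed
  moreover have "0 < real (card (verts G))"
    using assms(2) by (simp add: card_gt_0_iff)
  moreover have "\<forall>S\<in>set_pmf (pmf_of_set ?A). stable_set G S"
    using A st by auto
  ultimately show ?thesis
    unfolding fractionally_colourable_def by blast
qed

lemma fractionally_colourable_attained:
  assumes "graph G" "verts G \<noteq> {}"
  shows "fractionally_colourable G (Inf (Collect (fractionally_colourable G)))"
proof -
  interpret graph G by fact
  define K where "K = Collect (fractionally_colourable G)"
  define k0 where "k0 = Inf K"
  have K1: "1 \<le> k" if "k \<in> K" for k
    using that fractionally_colourable_ge_1[OF assms(2)] by (simp add: K_def)
  have Kne: "K \<noteq> {}"
    using fractionally_colourable_card[OF assms] by (auto simp: K_def)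
  have Kb: "bdd_below K" using K1 by (rule bdd_belowI)
  have k01: "1 \<le> k0"
    unfolding k0_def using Kne K1 by (rule cInf_greatest)
  have "\<exists>k\<in>K. k < k0 + 1 / real (Suc n)" for n
    using Kne Kb by (subst cInf_less_iff[symmetric]) (auto simp: k0_def)
  then obtain k where k: "\<And>n. k n \<in> K" "\<And>n. k n < k0 + 1 / real (Suc n)"
    by metis
  define A where "A = {S. stable_set G S}"
  have finA: "finite A"
    by (rule finite_subset[of _ "Pow (verts G)"]) (auto simp: A_def stable_set_def)
  have "\<forall>n. \<exists>p :: 'a set pmf. set_pmf p \<subseteq> A \<and>
      (\<forall>v\<in>verts G. measure_pmf.prob p {S. v \<in> S} \<ge> 1 / k n)"
    using k(1) unfolding K_def fractionally_colourable_def A_def by blast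
  then obtain p :: "nat \<Rightarrow> 'a set pmf" where
    p: "\<And>n. set_pmf (p n) \<subseteq> A"
       "\<And>n v. v \<in> verts G \<Longrightarrow> measure_pmf.prob (p n) {S. v \<in> S} \<ge> 1 / k n"
    by metis
  obtain r where r: "strict_mono r" "\<forall>S\<in>A. convergent (\<lambda>n. pmf (p (r n)) S)"
    using convergent_subseq_on_finite[OF finA, of "\<lambda>n. pmf (p n)"]
    by (auto simp: pmf_le_1)
  define w where "w S = (if S \<in> A then lim (\<lambda>n. pmf (p (r n)) S) else 0)" for S
  have lim: "(\<lambda>n. pmf (p (r n)) S) \<longlonglongrightarrow> w S" if "S \<in> A" for S
    using r(2) that by (auto simp: w_def convergent_LIMSEQ_iff)
  have w0: "0 \<le> w S" for S
  proof (cases "S \<in> A")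
    case True
    show ?thesis by (rule LIMSEQ_le_const[OF lim[OF True]]) auto
  qed (simp add: w_def)
  have limsum: "(\<lambda>n. measure_pmf.prob (p (r n)) B) \<longlonglongrightarrow> (\<Sum>S\<in>A \<inter> B. w S)" for B
    unfolding prob_finite_support[OF finA p(1)] by (intro tendsto_sum lim) auto
  have w1: "(\<Sum>S\<in>A. w S) = 1"
    using limsum[of UNIV] by (simp add: LIMSEQ_const_iff)
  have nn: "(\<integral>\<^sup>+ S. ennreal (w S) \<partial>count_space UNIV) = 1"
  proof -
    have "(\<integral>\<^sup>+ S. ennreal (w S) \<partial>count_space UNIV) = (\<Sum>S\<in>A. ennreal (w S))"
      using finA by (intro nn_integral_count_space') (auto simp: w_def)
    also have "\<dots> = 1" using w0 w1 by (simp add: sum_ennreal)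
    finally show ?thesis .
  qed
  define q where "q = embed_pmf w"
  have q: "pmf q S = w S" for S
    unfolding q_def using w0 nn by (rule pmf_embed_pmf)
  have qA: "set_pmf q \<subseteq> A"
    by (auto simp: set_pmf_iff q w_def split: if_splits)
  have "(\<lambda>n. k0 + 1 / real (Suc n)) \<longlonglongrightarrow> k0 + 0"
    by (intro tendsto_intros LIMSEQ_Suc[OF lim_1_over_n])
  then have up: "(\<lambda>n. k0 + 1 / real (Suc n)) \<longlonglongrightarrow> k0" by simp
  have "k0 \<le> k n" for n
    unfolding k0_def using k(1) Kb by (rule cInf_lower)
  moreover have "k n \<le> k0 + 1 / real (Suc n)" for n
    using k(2) by (rule less_imp_le)
  ultimately have "k \<longlonglongrightarrow> k0"
    by (intro tendsto_sandwich[OF _ _ tendsto_const up] always_eventually allI)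
  then have "(\<lambda>n. k (r n)) \<longlonglongrightarrow> k0"
    using LIMSEQ_subseq_LIMSEQ[OF _ r(1)] by (auto simp: o_def)
  then have lk: "(\<lambda>n. 1 / k (r n)) \<longlonglongrightarrow> 1 / k0"
    using k01 by (intro tendsto_intros) auto
  have "1 / k0 \<le> measure_pmf.prob q {S. v \<in> S}" if v: "v \<in> verts G" for v
  proof -
    have "1 / k0 \<le> (\<Sum>S\<in>A \<inter> {S. v \<in> S}. w S)"
      by (rule LIMSEQ_le[OF lk limsum]) (use p(2)[OF v] in auto)
    then show ?thesis by (simp add: prob_finite_support[OF finA qA] q)
  qed
  then have "fractionally_colourable G k0"
    unfolding fractionally_colourable_def using k01 qA by (auto simp: A_def)
  then show ?thesis by (simp add: k0_def K_def)
qed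

lemma
  assumes "graph G" "verts G \<noteq> {}"
  shows fractionally_colourable_fractional_chromatic_number:
      "fractionally_colourable G (fractional_chromatic_number G)"
    and fractional_chromatic_number_le:
      "fractionally_colourable G k \<Longrightarrow> fractional_chromatic_number G \<le> k"
proof -
  let ?k = "Inf (Collect (fractionally_colourable G))"
  have le: "?k \<le> j" if "fractionally_colourable G j" for j
    using that fractionally_colourable_ge_1[OF assms(2)]
    by (intro cInf_lower) (auto intro: bdd_belowI[of _ 1])
  have eq: "fractional_chromatic_number G = ?k"
    unfolding fractional_chromatic_number_def
    using fractionally_colourable_attained[OF assms] le by (rule Least_equality)
  show "fractionally_colourable G (fractional_chromatic_number G)"
    unfolding eq using assms by (rule fractionally_colourable_attained)
  show "fractional_chromatic_number G \<le> k" if "fractionally_colourable G k"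
    unfolding eq using that by (rule le)
qed

end

theory Submission
  imports Defs
begin

text \<open>
  Thin an optimal random stable set so that every vertex lies in it with probability exactly
  \<open>1 / k\<close>, and draw two independent copies \<open>S\<close>, \<open>T\<close>. The subgraph induced by \<open>S \<union> T\<close> is bipartite
  with at most \<open>2 * n / k\<close> vertices on average. An edge \<open>uv\<close> survives if \<open>u \<in> S, v \<in> T\<close> or
  \<open>v \<in> S, u \<in> T\<close>; these events exclude each other because \<open>S\<close> is stable, so \<open>2 * m / k\<^sup>2\<close> edges
  survive on average. Comparing the two expectations gives a nonempty outcome of average degree
  at least \<open>d / k\<close>.
\<close>

lemma stable_set_subset: "stable_set G S \<Longrightarrow> T \<subseteq> S \<Longrightarrow> stable_set G T"
  unfolding stable_set_def by blast

lemma stable_set_arcD: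
  "stable_set G S \<Longrightarrow> e \<in> arcs G \<Longrightarrow> tail G e \<in> S \<Longrightarrow> head G e \<notin> S"
  unfolding stable_set_def arcs_ends_conv by blast

lemma prob_bind_bernoulli:
  assumes "0 \<le> t" "t \<le> 1"
  shows "measure_pmf.prob (bind_pmf (bernoulli_pmf t) f) X =
    t * measure_pmf.prob (f True) X + (1 - t) * measure_pmf.prob (f False) X"
proof -
  have "ennreal (measure_pmf.prob (bind_pmf (bernoulli_pmf t) f) X) =
      ennreal (t * measure_pmf.prob (f True) X + (1 - t) * measure_pmf.prob (f False) X)"
    using assms unfolding measure_pmf.emeasure_eq_measure[symmetric] emeasure_bind_pmf
    by (subst nn_integral_bernoulli_pmf)
      (simp_all add: measure_pmf.emeasure_eq_measure ennreal_plus ennreal_mult mult.commute)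
  then show ?thesis using assms by (subst (asm) ennreal_inj) auto
qed

text \<open>Vertices are treated one at a time: deleting \<open>v\<close> from the random set with a
  suitable probability lowers the marginal of \<open>v\<close> to \<open>q v\<close> and leaves all
  other marginals alone. The last conjunct strengthens the induction: a vertex not yet treated keeps
  its original marginal, so the lower bound \<open>q v\<close> is still available for it.\<close>

lemma thinned_pmf_exists:
  fixes p :: "'a set pmf" and q :: "'a \<Rightarrow> real"
  assumes "finite V"
    and q: "\<And>v. v \<in> V \<Longrightarrow> 0 < q v \<and> q v \<le> measure_pmf.prob p {S. v \<in> S}"
  shows "\<exists>p'. (\<forall>S'\<in>set_pmf p'. \<exists>S\<in>set_pmf p. S' \<subseteq> S) \<and>
    (\<forall>v\<in>V. measure_pmf.prob p' {S. v \<in> S} = q v) \<and>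
    (\<forall>v. v \<notin> V \<longrightarrow> measure_pmf.prob p' {S. v \<in> S} = measure_pmf.prob p {S. v \<in> S})"
  using assms
proof (induction V rule: finite_induct)
  case empty
  show ?case by (rule exI[of _ p]) auto
next
  case (insert v V)
  then obtain r where r: "\<And>S'. S' \<in> set_pmf r \<Longrightarrow> \<exists>S\<in>set_pmf p. S' \<subseteq> S"
      "\<And>u. u \<in> V \<Longrightarrow> measure_pmf.prob r {S. u \<in> S} = q u"
      "\<And>u. u \<notin> V \<Longrightarrow> measure_pmf.prob r {S. u \<in> S} = measure_pmf.prob p {S. u \<in> S}"
    by (metis insertCI)
  \<comment> \<open>The probability of keeping \<open>v\<close> given that it is present. The
    divisor is positive since it is at least \<open>q v\<close>.\<close>
  define t where "t = q v / measure_pmf.prob r {S. v \<in> S}"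
  have qv: "0 < q v" "q v \<le> measure_pmf.prob r {S. v \<in> S}"
    using insert.prems insert.hyps r(3) by auto
  have t: "0 \<le> t" "t \<le> 1" using qv by (auto simp: t_def)
  \<comment> \<open>An independent coin decides: with probability \<open>t\<close> the sampled set
    is kept, otherwise \<open>v\<close> is removed from it.\<close>
  define p' where "p' = bind_pmf (bernoulli_pmf t) (\<lambda>b. if b then r else map_pmf (\<lambda>S. S - {v}) r)"
  have "measure_pmf.prob p' {S. v \<in> S} = t * measure_pmf.prob r {S. v \<in> S}"
    unfolding p'_def by (subst prob_bind_bernoulli[OF t]) (simp add: vimage_def)
  then have v: "measure_pmf.prob p' {S. v \<in> S} = q v"
    using qv by (simp add: t_def)
  have u: "measure_pmf.prob p' {S. u \<in> S} = measure_pmf.prob r {S. u \<in> S}" if "u \<noteq> v" for u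
    unfolding p'_def using that
    by (subst prob_bind_bernoulli[OF t]) (simp add: vimage_def algebra_simps)
  have "\<exists>S\<in>set_pmf p. S' \<subseteq> S" if S': "S' \<in> set_pmf p'" for S'
  proof -
    have "\<exists>S\<in>set_pmf r. S' \<subseteq> S"
      using S' unfolding p'_def by (auto split: if_splits)
    then show ?thesis using r(1) by (meson order_trans)
  qed
  moreover have "measure_pmf.prob p' {S. u \<in> S} = q u" if "u \<in> insert v V" for u
    using that v u[of u] r(2)[of u] by (cases "u = v") simp_all
  moreover have "measure_pmf.prob p' {S. u \<in> S} = measure_pmf.prob p {S. u \<in> S}"
    if "u \<notin> insert v V" for u
    using that u[of u] r(3)[of u] by simp
  ultimately show ?case by blast
qed

text \<open>Each arc is counted once, at its tail. As arcs are counted and not edges, no factor 2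
  appears.\<close>

lemma (in fin_digraph) average_degree_eq:
  "average_degree G = real (card (arcs G)) / real (card (verts G))"
proof -
  have "card (arcs G) = card (\<Union>v\<in>verts G. out_arcs G v)"
    by (rule arg_cong[where f=card]) auto
  also have "\<dots> = (\<Sum>v\<in>verts G. out_degree G v)"
    unfolding out_degree_def by (rule card_UN_disjoint) auto
  finally show ?thesis by (simp add: average_degree_def)
qed

text \<open>\<open>S\<close> and \<open>T\<close> may overlap, so the colour classes are
  \<open>S\<close> and \<open>T - S\<close>.\<close>

lemma bipartite_induce_union:
  assumes "stable_set G S" "stable_set G T"
  shows "bipartite (G \<restriction> (S \<union> T))"
proof -
  have "stable_set (G \<restriction> (S \<union> T)) U" if "stable_set G U" "U \<subseteq> S \<union> T" for U
    using that dominates_induce_subgraphD unfolding stable_set_def induce_subgraph_verts by metis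
  then have "stable_set (G \<restriction> (S \<union> T)) S" "stable_set (G \<restriction> (S \<union> T)) (T - S)"
    using assms stable_set_subset[of G T "T - S"] by blast+
  then show ?thesis unfolding bipartite_def by (intro exI[of _ S] exI[of _ "T - S"]) auto
qed

text \<open>Turns the inequality that the averaging argument yields for one pair into a degree
  bound. The sum of cardinalities bounds the number of vertices of the union from above, and the sum
  over arcs bounds its number of arcs from below.\<close>

lemma (in fin_digraph) average_degree_induce_union_ge:
  assumes S: "stable_set G S" and T: "stable_set G T" and "S \<union> T \<noteq> {}" and c: "0 \<le> c"
    and le: "c * (real (card S) + real (card T)) \<le>
      (\<Sum>e\<in>arcs G. of_bool (tail G e \<in> S) * of_bool (head G e \<in> T) +
        of_bool (tail G e \<in> T) * of_bool (head G e \<in> S))"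
  shows "c \<le> average_degree (G \<restriction> (S \<union> T))"
proof -
  let ?H = "G \<restriction> (S \<union> T)"
  have sub: "S \<union> T \<subseteq> verts G" using S T by (auto simp: stable_set_def)
  interpret H: fin_digraph ?H
    using sub by (intro fin_digraph_subgraph induced_imp_subgraph induced_induce)
  have fin: "finite (S \<union> T)" using sub finite_verts finite_subset by blast
  have "c * real (card (S \<union> T)) \<le> c * (real (card S) + real (card T))"
    using c card_Un_le[of S T] by (intro mult_left_mono) linarith+
  also note le
  also have "(\<Sum>e\<in>arcs G. of_bool (tail G e \<in> S) * of_bool (head G e \<in> T) +
        of_bool (tail G e \<in> T) * of_bool (head G e \<in> S)) \<le>
      (\<Sum>e\<in>arcs G. of_bool (e \<in> arcs ?H) :: real)"
    \<comment> \<open>If both products were 1, tail and head would both lie in the stable set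
      \<open>S\<close>. So each summand is at most 1, and it is 0 unless both ends lie in S \<union>
      T.\<close>
    using S T by (intro sum_mono) (auto dest: stable_set_arcD)
  also have "\<dots> = real (card (arcs ?H))"
    by (simp add: sum.If_cases of_bool_def Int_def conj_ac)
  finally show ?thesis
    using fin assms(3) unfolding H.average_degree_eq
    by (simp add: field_simps card_gt_0_iff)
qed

theorem theorem3p1:
  fixes G :: "('a, 'b) pre_digraph" and k d :: real
  assumes "graph G"
    and "verts G \<noteq> {}"
    and "fractional_chromatic_number G = k"
    and "average_degree G = d"
  shows "\<exists>H. induced_subgraph H G \<and> verts H \<noteq> {} \<and> bipartite H \<and> average_degree H \<ge> d / k"
proof -
  interpret graph G by fact
  have "fractionally_colourable G k"
    using fractionally_colourable_fractional_chromatic_number[OF assms(1,2)] assms(3) by simp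
  then obtain p :: "'a set pmf" where k: "0 < k"
    and p: "\<And>S. S \<in> set_pmf p \<Longrightarrow> stable_set G S"
      "\<And>v. v \<in> verts G \<Longrightarrow> 1 / k \<le> measure_pmf.prob p {S. v \<in> S}"
    unfolding fractionally_colourable_def by blast
  \<comment> \<open>Marginals of exactly \<open>1 / k\<close> are needed since the expected size of
    the sets has to be bounded from above, whereas the colouring bounds it only from below.\<close>
  obtain r where r: "\<And>S'. S' \<in> set_pmf r \<Longrightarrow> \<exists>S\<in>set_pmf p. S' \<subseteq> S"
      "\<And>v. v \<in> verts G \<Longrightarrow> measure_pmf.prob r {S. v \<in> S} = 1 / k"
    using thinned_pmf_exists[of "verts G" "\<lambda>_. 1 / k" p] p(2) k finite_verts
    by (metis zero_less_divide_1_iff)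
  define A where "A = {S. stable_set G S}"
  have finA: "finite A"
    by (rule finite_subset[of _ "Pow (verts G)"]) (auto simp: A_def stable_set_def)
  have rA: "set_pmf r \<subseteq> A"
    using r(1) p(1) stable_set_subset unfolding A_def by blast
  have sum1: "(\<Sum>S\<in>A. pmf r S) = 1"
    using prob_finite_support[OF finA rA, of UNIV] by simp
  have P: "(\<Sum>S\<in>A. pmf r S * of_bool (v \<in> S)) = 1 / k" if "v \<in> verts G" for v
    using r(2)[OF that] finA unfolding prob_finite_support[OF finA rA]
    by (simp add: of_bool_def if_distrib sum.If_cases cong: if_cong)
  define n where "n = real (card (verts G))"
  \<comment> \<open>\<open>m\<close> counts arcs, that is, twice the edges.\<close>
  define m where "m = real (card (arcs G))"
  define c where "c = d / k"
  have n: "0 < n" using assms(2) by (simp add: n_def card_gt_0_iff)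
  have d: "d = m / n" using average_degree_eq assms(4) by (simp add: m_def n_def)
  have c: "0 \<le> c" using k n by (simp add: c_def d m_def)
  define e2 where "e2 S T = (\<Sum>e\<in>arcs G. of_bool (tail G e \<in> S) * of_bool (head G e \<in> T) +
        of_bool (tail G e \<in> T) * of_bool (head G e \<in> S) :: real)" for S T
  have E_card: "(\<Sum>S\<in>A. pmf r S * real (card S)) = n / k"
  proof -
    have "(\<Sum>S\<in>A. pmf r S * real (card S)) =
        (\<Sum>S\<in>A. \<Sum>v\<in>verts G. pmf r S * of_bool (v \<in> S))"
    proof (intro sum.cong refl)
      fix S assume "S \<in> A"
      then have "S = verts G \<inter> S" by (auto simp: A_def stable_set_def)
      then have "real (card S) = (\<Sum>v\<in>verts G. of_bool (v \<in> S))"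
        by (simp add: of_bool_def sum.If_cases)
      then show "pmf r S * real (card S) = (\<Sum>v\<in>verts G. pmf r S * of_bool (v \<in> S))"
        by (simp add: sum_distrib_left)
    qed
    also have "\<dots> = (\<Sum>v\<in>verts G. \<Sum>S\<in>A. pmf r S * of_bool (v \<in> S))"
      by (rule sum.swap)
    also have "\<dots> = n / k" by (simp add: P n_def)
    finally show ?thesis .
  qed
  have E_e2: "(\<Sum>S\<in>A. \<Sum>T\<in>A. pmf r S * pmf r T * e2 S T) = 2 * m / k\<^sup>2"
  proof -
    let ?P = "\<lambda>v. \<Sum>S\<in>A. pmf r S * of_bool (v \<in> S)"
    have "(\<Sum>S\<in>A. \<Sum>T\<in>A. pmf r S * pmf r T * e2 S T) =
       (\<Sum>S\<in>A. \<Sum>e\<in>arcs G. \<Sum>T\<in>A.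
          (pmf r S * of_bool (tail G e \<in> S)) * (pmf r T * of_bool (head G e \<in> T)) +
          (pmf r S * of_bool (head G e \<in> S)) * (pmf r T * of_bool (tail G e \<in> T)))"
      unfolding e2_def sum_distrib_left
      by (intro sum.cong refl, subst sum.swap) (intro sum.cong refl, simp add: algebra_simps)
    \<comment> \<open>Independence of the two copies: for a fixed arc the double sum factors into
      the marginals of its ends.\<close>
    also have "\<dots> = (\<Sum>e\<in>arcs G. ?P (tail G e) * ?P (head G e) + ?P (head G e) * ?P (tail G e))"
      by (subst sum.swap) (simp only: sum.distrib sum_product)
    also have "\<dots> = (\<Sum>e\<in>arcs G. 2 / k\<^sup>2)"
      by (intro sum.cong refl) (simp add: P power2_eq_square)
    finally show ?thesis by (simp add: m_def)
  qed
  have E_cards: "(\<Sum>S\<in>A. \<Sum>T\<in>A. pmf r S * pmf r T * (real (card S) + real (card T))) = 2 * n / k"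
  proof -
    have "(\<Sum>S\<in>A. \<Sum>T\<in>A. pmf r S * pmf r T * (real (card S) + real (card T))) =
      (\<Sum>S\<in>A. \<Sum>T\<in>A. (pmf r S * real (card S)) * pmf r T) +
      (\<Sum>S\<in>A. \<Sum>T\<in>A. pmf r S * (pmf r T * real (card T)))"
      by (simp add: sum.distrib algebra_simps)
    also have "\<dots> = 2 * n / k"
      unfolding sum_product[symmetric] by (simp add: sum1 E_card)
    finally show ?thesis .
  qed
  \<comment> \<open>The value \<open>c = d / k\<close> is the ratio of the two expectations
    \<open>2 * m / k\<^sup>2\<close> and \<open>2 * n / k\<close>, so the mean of the difference
    vanishes.\<close>
  have E0: "(\<Sum>S\<in>A. \<Sum>T\<in>A. pmf r S * pmf r T * (e2 S T - c * (real (card S) + real (card T)))) = 0"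
  proof -
    have "(\<Sum>S\<in>A. \<Sum>T\<in>A. pmf r S * pmf r T * (e2 S T - c * (real (card S) + real (card T)))) =
      (\<Sum>S\<in>A. \<Sum>T\<in>A. pmf r S * pmf r T * e2 S T) -
      c * (\<Sum>S\<in>A. \<Sum>T\<in>A. pmf r S * pmf r T * (real (card S) + real (card T)))"
      unfolding sum_distrib_left sum_subtractf[symmetric]
      by (intro sum.cong refl) (simp add: algebra_simps)
    also have "\<dots> = 0"
      using k n unfolding E_e2 E_cards by (simp add: c_def d power2_eq_square)
    finally show ?thesis .
  qed
  \<comment> \<open>A zero mean alone is not enough: the pair of empty sets has value 0 and could be
    the only outcome with a nonnegative value.\<close>
  have "\<exists>S\<in>A. \<exists>T\<in>A. S \<union> T \<noteq> {} \<and> c * (real (card S) + real (card T)) \<le> e2 S T"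
  proof (rule ccontr)
    assume "\<not> ?thesis"
    then have neg: "e2 S T - c * (real (card S) + real (card T)) < 0"
      if "S \<in> A" "T \<in> A" "S \<union> T \<noteq> {}" for S T
      using that by force
    define f where "f S T = pmf r S * pmf r T * (e2 S T - c * (real (card S) + real (card T)))" for S T
    have f: "f S T \<le> 0" if "S \<in> A" "T \<in> A" for S T
    proof (cases "S \<union> T = {}")
      case False
      then show ?thesis unfolding f_def using neg[OF that False]
        by (intro mult_nonneg_nonpos) auto
    qed (simp add: f_def e2_def)
    obtain v where v: "v \<in> verts G" using assms(2) by blast
    \<comment> \<open>A set of positive mass containing \<open>v\<close> exists because
      \<open>v\<close> has marginal \<open>1 / k > 0\<close>. The pair \<open>S0\<close>,
      \<open>S0\<close> is then nonempty with positive weight, so its strictly negative term makes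
      the whole sum negative.\<close>
    have "\<exists>S0\<in>set_pmf r. v \<in> S0"
      using r(2)[OF v] k measure_pmf_zero_iff[of r "{S. v \<in> S}"] by auto
    then obtain S0 where S0: "S0 \<in> set_pmf r" "v \<in> S0" by blast
    have S0A: "S0 \<in> A" using S0 rA by blast
    have "f S0 S0 < 0"
      unfolding f_def using neg[OF S0A S0A] S0
      by (intro mult_pos_neg) (auto simp: pmf_positive)
    then have "(\<Sum>T\<in>A. f S0 T) < 0"
      using sum_strict_mono_ex1[OF finA, of "f S0" "\<lambda>_. 0"] f S0A by auto
    moreover have "(\<Sum>T\<in>A. f S T) \<le> 0" if "S \<in> A" for S
      using f that by (intro sum_nonpos) auto
    ultimately have "(\<Sum>S\<in>A. \<Sum>T\<in>A. f S T) < 0"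
      using sum_strict_mono_ex1[OF finA, of "\<lambda>S. \<Sum>T\<in>A. f S T" "\<lambda>_. 0"] S0A by auto
    then show False using E0 by (simp add: f_def)
  qed
  then obtain S T where ST: "stable_set G S" "stable_set G T" "S \<union> T \<noteq> {}"
    "c * (real (card S) + real (card T)) \<le> e2 S T"
    by (auto simp: A_def)
  have "S \<union> T \<subseteq> verts G" using ST by (auto simp: stable_set_def)
  then have "induced_subgraph (G \<restriction> (S \<union> T)) G"
    by (rule induced_induce)
  moreover have "d / k \<le> average_degree (G \<restriction> (S \<union> T))"
    using average_degree_induce_union_ge[OF ST(1-3) c] ST(4) by (simp add: e2_def c_def)
  ultimately show ?thesis
    using bipartite_induce_union[OF ST(1,2)] ST(3)
    by (intro exI[of _ "G \<restriction> (S \<union> T)"]) simp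
qed

end
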